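(* Let $X$ be a topological space and $f:X\to X$ a continuous map. Then $f$ is positively topologically expansive if at least one of the following conditions holds. (1) There is a finite open cover $\mathcal{U}=\{U_1,\ldots,U_m\}$ of $X$ such that, for all $x,y\in X$, if $\{f^n(x),f^n(y)\}\prec\mathcal{U}$ for all $n\in\mathbb{N}$, then $x=y$. (2) $X$ is a $T_1$-space and has a finite open cover $\mathcal{U}=\{U_i : 0\leq i\leq m\}$ such that for every open cover $\mathcal{V}$ of $X$ there is $n\in\mathbb{N}$ with $f^{-n}(\mathcal{U})\prec\mathcal{V}$. (3) $X$ is a $T_1$-space and has a finite open cover $\mathcal{U}=\{U_i : 0\leq i\leq n\}$ such that for every open cover $\mathcal{V}$ of $X$ there is $N\in\mathbb{N}$ with $\bigwedge_{0\leq i\leq N}f^{-i}(\mathcal{U})\prec\mathcal{V}$.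
   Context: $\mathbb{N}=\{1,2,3,\ldots\}$. For a subset $A\subseteq X$ and a cover $\mathcal{U}$ of $X$, write $A\prec\mathcal{U}$ if there exists $C\in\mathcal{U}$ with $A\subseteq C$. For a family $\mathcal{W}$ of subsets of $X$, $\mathcal{W}\prec\mathcal{U}$ means $A\prec\mathcal{U}$ for all $A\in\mathcal{W}$. For covers $\mathcal{U},\mathcal{V}$, the join is $\mathcal{U}\wedge\mathcal{V}=\{U\cap V : U\in\mathcal{U},V\in\mathcal{V}\}$, and $\bigwedge_{0\le i\le N}$ denotes the iterated join. Also $f^{-n}(\mathcal{U})=\{f^{-n}(U):U\in\mathcal{U}\}$, where $f^{-n}(U)$ is the preimage of $U$ under $f^n$. A continuous map $f:X\to X$ on a topological space $X$ is positively topologically expansive if there is a neighborhood $U\subseteq X\times X$ (in the product topology) of the diagonal $\Delta_X=\{(x,x):x\in X\}$ such that for any $x,y\in X$ with $x\neq y$ there exists an integer $n\geq 0$ with $(f^n(x),f^n(y))\notin U$. *)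

theory Defs
  imports "HOL-Analysis.T1_Spaces"
begin

definition open_cover :: "'a topology \<Rightarrow> 'a set set \<Rightarrow> bool" where
  "open_cover X \<U> \<longleftrightarrow> (\<forall>U\<in>\<U>. openin X U) \<and> \<Union>\<U> = topspace X"

definition subordinate :: "'a set \<Rightarrow> 'a set set \<Rightarrow> bool" where
  "subordinate A \<U> \<longleftrightarrow> (\<exists>C\<in>\<U>. A \<subseteq> C)"

definition family_subordinate :: "'a set set \<Rightarrow> 'a set set \<Rightarrow> bool" where
  "family_subordinate \<W> \<U> \<longleftrightarrow> (\<forall>A\<in>\<W>. subordinate A \<U>)"

definition join :: "'a set set \<Rightarrow> 'a set set \<Rightarrow> 'a set set" where
  "join \<U> \<V> = {U \<inter> V | U V. U \<in> \<U> \<and> V \<in> \<V>}"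

fun iterated_join :: "(nat \<Rightarrow> 'a set set) \<Rightarrow> nat \<Rightarrow> 'a set set" where
  "iterated_join F 0 = F 0"
| "iterated_join F (Suc N) = join (iterated_join F N) (F (Suc N))"

text \<open>The map is a total function on the ambient type, so preimages of members of a cover are
  taken inside the space.\<close>
definition preimage_cover :: "'a topology \<Rightarrow> ('a \<Rightarrow> 'a) \<Rightarrow> nat \<Rightarrow> 'a set set \<Rightarrow> 'a set set" where
  "preimage_cover X f n \<U> = {{x \<in> topspace X. (f ^^ n) x \<in> U} | U. U \<in> \<U>}"

text \<open>A neighborhood of the diagonal need not be open: it is a set containing an open set that
  contains the diagonal.\<close>
definition diagonal_neighborhood :: "'a topology \<Rightarrow> ('a \<times> 'a) set \<Rightarrow> bool" where
  "diagonal_neighborhood X U \<longleftrightarrow> U \<subseteq> topspace X \<times> topspace X \<and>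
     (\<exists>W. openin (prod_topology X X) W \<and> {(x, x) | x. x \<in> topspace X} \<subseteq> W \<and> W \<subseteq> U)"

definition positively_topologically_expansive :: "'a topology \<Rightarrow> ('a \<Rightarrow> 'a) \<Rightarrow> bool" where
  "positively_topologically_expansive X f \<longleftrightarrow> continuous_map X X f \<and>
     (\<exists>U. diagonal_neighborhood X U \<and>
       (\<forall>x\<in>topspace X. \<forall>y\<in>topspace X. x \<noteq> y \<longrightarrow> (\<exists>n. ((f ^^ n) x, (f ^^ n) y) \<notin> U)))"

end

theory Submission
  imports Defs
begin

text \<open>
  An open cover \<open>\<U>\<close> turns the diagonal into the open neighborhood
  \<open>\<Union>U\<in>\<U>. U \<times> U\<close>, and a pair of points lies in it exactly when some member of
  \<open>\<U>\<close> contains both. So \<open>f\<close> is positively topologically expansive once the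
  orbits of any two distinct points are at some time not jointly contained in a member of
  \<open>\<U>\<close> (\<open>expansive_if_separating_cover\<close>). The first condition says this directly.

  Under the other two, let \<open>x \<noteq> y\<close>. In a \<open>T\<^sub>1\<close>-space
  \<open>{X - {x}, X - {y}}\<close> is an open cover, no member of which contains both points
  (\<open>t1_separating_open_cover\<close>), and the same is then true of every family refining it.
  If at every time the iterates of \<open>x\<close> and \<open>y\<close> lay in a common member of
  \<open>\<U>\<close>, then \<open>x\<close> and \<open>y\<close> would lie in a common member of each preimage cover
  \<open>f\<^sup>-\<^sup>n(\<U>)\<close>, and by intersecting these members also in a common member of each
  iterated join, contradicting the refinement.
\<close>

lemma openin_Union_squares:
  assumes "open_cover X \<U>"
  shows "openin (prod_topology X X) (\<Union>U\<in>\<U>. U \<times> U)"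
  using assms by (auto simp: open_cover_def openin_prod_Times_iff)

lemma expansive_if_separating_cover:
  assumes f: "continuous_map X X f"
    and \<U>: "open_cover X \<U>"
    and separates: "\<And>x y. \<lbrakk>x \<in> topspace X; y \<in> topspace X; x \<noteq> y\<rbrakk> \<Longrightarrow>
      \<exists>n. \<not> subordinate {(f ^^ n) x, (f ^^ n) y} \<U>"
  shows "positively_topologically_expansive X f"
proof -
  let ?W = "\<Union>U\<in>\<U>. U \<times> U"
  have "diagonal_neighborhood X ?W"
    unfolding diagonal_neighborhood_def
  proof (intro conjI exI)
    show "openin (prod_topology X X) ?W"
      using \<U> by (rule openin_Union_squares)
  qed (use \<U> in \<open>auto simp: open_cover_def\<close>)
  moreover have "\<exists>n. ((f ^^ n) x, (f ^^ n) y) \<notin> ?W"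
    if "x \<in> topspace X" "y \<in> topspace X" "x \<noteq> y" for x y
    using separates[OF that] by (auto simp: subordinate_def)
  ultimately show ?thesis
    using f unfolding positively_topologically_expansive_def by blast
qed

lemma t1_separating_open_cover:
  assumes "t1_space X" "x \<in> topspace X" "y \<in> topspace X" "x \<noteq> y"
  shows "open_cover X {topspace X - {x}, topspace X - {y}}"
  using assms by (auto simp: open_cover_def t1_space_openin_delete_alt)

lemma subordinate_preimage_cover:
  assumes "A \<subseteq> topspace X" "subordinate ((f ^^ n) ` A) \<U>"
  shows "subordinate A (preimage_cover X f n \<U>)"
proof -
  obtain U where "U \<in> \<U>" "(f ^^ n) ` A \<subseteq> U"
    using assms(2) unfolding subordinate_def by blast
  then have "{x \<in> topspace X. (f ^^ n) x \<in> U} \<in> preimage_cover X f n \<U>"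
    and "A \<subseteq> {x \<in> topspace X. (f ^^ n) x \<in> U}"
    using assms(1) by (auto simp: preimage_cover_def)
  then show ?thesis
    unfolding subordinate_def by (rule bexI[rotated])
qed

lemma subordinate_iterated_join:
  assumes "\<And>i. i \<le> N \<Longrightarrow> subordinate A (F i)"
  shows "subordinate A (iterated_join F N)"
  using assms
proof (induction N)
  case (Suc N)
  have "subordinate A (iterated_join F N)" "subordinate A (F (Suc N))"
    using Suc by simp_all
  then obtain C D where "C \<in> iterated_join F N" "A \<subseteq> C" "D \<in> F (Suc N)" "A \<subseteq> D"
    unfolding subordinate_def by blast
  then have "C \<inter> D \<in> iterated_join F (Suc N)" "A \<subseteq> C \<inter> D"
    by (auto simp: join_def)
  then show ?case
    unfolding subordinate_def by blast
qed simp

lemma subordinate_trans: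
  assumes "subordinate A \<W>" "family_subordinate \<W> \<V>"
  shows "subordinate A \<V>"
  using assms unfolding subordinate_def family_subordinate_def by (meson subset_trans)

text \<open>
  The common core of the two refinement conditions: both produce, for every open cover, a
  refining family that absorbs each set whose iterated images all fit into members of
  \<open>\<U>\<close>. For a two-point set and an open cover that separates its points this is
  impossible.
\<close>
lemma expansive_if_orbitwise_refinement:
  assumes f: "continuous_map X X f" and t1: "t1_space X" and \<U>: "open_cover X \<U>"
    and refines: "\<And>\<V>. open_cover X \<V> \<Longrightarrow>
      \<exists>\<W>. family_subordinate \<W> \<V> \<and>
        (\<forall>A \<subseteq> topspace X. (\<forall>n. subordinate ((f ^^ n) ` A) \<U>) \<longrightarrow> subordinate A \<W>)"
  shows "positively_topologically_expansive X f"
proof (rule expansive_if_separating_cover[OF f \<U>], rule ccontr)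
  fix x y
  assume xy: "x \<in> topspace X" "y \<in> topspace X" "x \<noteq> y"
    and close: "\<nexists>n. \<not> subordinate {(f ^^ n) x, (f ^^ n) y} \<U>"
  let ?V = "{topspace X - {x}, topspace X - {y}}"
  obtain \<W> where \<W>: "family_subordinate \<W> ?V"
    and orbit: "\<forall>A \<subseteq> topspace X. (\<forall>n. subordinate ((f ^^ n) ` A) \<U>) \<longrightarrow> subordinate A \<W>"
    using refines[OF t1_separating_open_cover[OF t1 xy]] by (elim exE conjE)
  have "subordinate {x, y} \<W>"
    using orbit[rule_format, of "{x, y}"] xy close by simp
  then have "subordinate {x, y} ?V"
    using \<W> by (rule subordinate_trans)
  then show False
    by (auto simp: subordinate_def)
qed

theorem proposition4p7:
  fixes X :: "'a topology" and f :: "'a \<Rightarrow> 'a"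
  assumes "continuous_map X X f"
    and "(\<exists>\<U>. finite \<U> \<and> open_cover X \<U> \<and>
            (\<forall>x\<in>topspace X. \<forall>y\<in>topspace X.
               (\<forall>n\<ge>1. subordinate {(f ^^ n) x, (f ^^ n) y} \<U>) \<longrightarrow> x = y))
       \<or> (t1_space X \<and>
          (\<exists>\<U>. finite \<U> \<and> open_cover X \<U> \<and>
            (\<forall>\<V>. open_cover X \<V> \<longrightarrow> (\<exists>n\<ge>1. family_subordinate (preimage_cover X f n \<U>) \<V>))))
       \<or> (t1_space X \<and>
          (\<exists>\<U>. finite \<U> \<and> open_cover X \<U> \<and>
            (\<forall>\<V>. open_cover X \<V> \<longrightarrow>
               (\<exists>N\<ge>1. family_subordinate (iterated_join (\<lambda>i. preimage_cover X f i \<U>) N) \<V>))))"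
  shows "positively_topologically_expansive X f"
  using assms(2)
proof (elim disjE conjE exE)
  fix \<U>
  assume \<U>: "open_cover X \<U>"
    and "\<forall>x\<in>topspace X. \<forall>y\<in>topspace X.
      (\<forall>n\<ge>1. subordinate {(f ^^ n) x, (f ^^ n) y} \<U>) \<longrightarrow> x = y"
  then have "\<exists>n. \<not> subordinate {(f ^^ n) x, (f ^^ n) y} \<U>"
    if "x \<in> topspace X" "y \<in> topspace X" "x \<noteq> y" for x y
    using that by metis
  then show ?thesis
    by (rule expansive_if_separating_cover[OF assms(1) \<U>])
next
  fix \<U>
  assume t1: "t1_space X" and \<U>: "open_cover X \<U>"
    and refines: "\<forall>\<V>. open_cover X \<V> \<longrightarrow>
      (\<exists>n\<ge>1. family_subordinate (preimage_cover X f n \<U>) \<V>)"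
  show ?thesis
  proof (rule expansive_if_orbitwise_refinement[OF assms(1) t1 \<U>])
    fix \<V> assume "open_cover X \<V>"
    then obtain n where "family_subordinate (preimage_cover X f n \<U>) \<V>"
      using refines by blast
    then show "\<exists>\<W>. family_subordinate \<W> \<V> \<and>
        (\<forall>A \<subseteq> topspace X. (\<forall>n. subordinate ((f ^^ n) ` A) \<U>) \<longrightarrow> subordinate A \<W>)"
      by (intro exI[of _ "preimage_cover X f n \<U>"]) (simp add: subordinate_preimage_cover)
  qed
next
  fix \<U>
  assume t1: "t1_space X" and \<U>: "open_cover X \<U>"
    and refines: "\<forall>\<V>. open_cover X \<V> \<longrightarrow>
      (\<exists>N\<ge>1. family_subordinate (iterated_join (\<lambda>i. preimage_cover X f i \<U>) N) \<V>)"
  show ?thesis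
  proof (rule expansive_if_orbitwise_refinement[OF assms(1) t1 \<U>])
    fix \<V> assume "open_cover X \<V>"
    then obtain N
      where "family_subordinate (iterated_join (\<lambda>i. preimage_cover X f i \<U>) N) \<V>"
      using refines by blast
    moreover have "subordinate A (iterated_join (\<lambda>i. preimage_cover X f i \<U>) N)"
      if "A \<subseteq> topspace X" "\<forall>n. subordinate ((f ^^ n) ` A) \<U>" for A
      using that by (intro subordinate_iterated_join subordinate_preimage_cover) auto
    ultimately show "\<exists>\<W>. family_subordinate \<W> \<V> \<and>
        (\<forall>A \<subseteq> topspace X. (\<forall>n. subordinate ((f ^^ n) ` A) \<U>) \<longrightarrow> subordinate A \<W>)"
      by blast
  qed
qed

end
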